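(* Let $\{W_t\}_{0\le t\le 1}$ be a standard real-valued Brownian motion. For each $\lambda>0$, $$0\le \mathbf{E}\,\Phi_{[0,1],\lambda}(W)-\frac1\lambda\le\lambda,$$ and thus in particular $\mathbf{E}\,\Phi_{[0,1],\lambda}(W)=1/\lambda+O(\lambda)$ as $\lambda\to0$.
   Context: For $a<b$, a continuous function $f:[a,b]\to\mathbf{R}$ and $\lambda>0$, the regularized total variation of $f$ on $[a,b]$ is $$\Phi_{[a,b],\lambda}(f)=\sup_{k\ge0}\ \sup_{a=t_0<t_1<\cdots<t_{k+1}=b}\left(\sum_{i=1}^{k+1}|f(t_i)-f(t_{i-1})|-\lambda k\right).$$ *)

theory Defs
  imports "HOL-Probability.Probability"
begin

text \<open>A partition a = t 0 < t 1 < ... < t (k + 1) = b with k interior points; only the values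
  of t on {0..k + 1} matter.\<close>

definition partition_points :: "real \<Rightarrow> real \<Rightarrow> nat \<Rightarrow> (nat \<Rightarrow> real) \<Rightarrow> bool" where
  "partition_points a b k t \<longleftrightarrow> t 0 = a \<and> t (Suc k) = b \<and> (\<forall>i\<le>k. t i < t (Suc i))"

definition reg_total_variation :: "real \<Rightarrow> real \<Rightarrow> real \<Rightarrow> (real \<Rightarrow> real) \<Rightarrow> real" where
  "reg_total_variation a b l f =
     Sup {(\<Sum>i\<le>k. \<bar>f (t (Suc i)) - f (t i)\<bar>) - l * real k | k t. partition_points a b k t}"

text \<open>The supremum above is taken in the reals. The next two facts show that it is a
  genuine supremum (of a nonempty set that is bounded above) for continuous functions.\<close>

lemma reg_total_variation_nonempty:
  fixes f :: "real \<Rightarrow> real"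
  assumes "a < b"
  shows "{(\<Sum>i\<le>k. \<bar>f (t (Suc i)) - f (t i)\<bar>) - l * real k | k t. partition_points a b k t} \<noteq> {}"
proof -
  have "partition_points a b 0 (\<lambda>i. if i = 0 then a else b)"
    using assms by (simp add: partition_points_def)
  then show ?thesis by blast
qed

lemma reg_total_variation_bdd_above:
  fixes f :: "real \<Rightarrow> real"
  assumes "a < b" "l > 0" "continuous_on {a..b} f"
  shows "bdd_above {(\<Sum>i\<le>k. \<bar>f (t (Suc i)) - f (t i)\<bar>) - l * real k | k t. partition_points a b k t}"
proof -
  have "uniformly_continuous_on {a..b} f"
    using assms by (simp add: compact_uniformly_continuous)
  then obtain d where d: "d > 0"
    "\<And>x y. x \<in> {a..b} \<Longrightarrow> y \<in> {a..b} \<Longrightarrow> dist y x < d \<Longrightarrow> dist (f y) (f x) < l"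
    using \<open>l > 0\<close> unfolding uniformly_continuous_on_def by metis
  have "bounded (f ` {a..b})"
    using assms by (simp add: compact_continuous_image compact_imp_bounded)
  then obtain B where B: "B > 0" "\<And>x. x \<in> {a..b} \<Longrightarrow> \<bar>f x\<bar> \<le> B"
    unfolding bounded_pos by auto
  have "(\<Sum>i\<le>k. \<bar>f (t (Suc i)) - f (t i)\<bar>) - l * real k \<le> 2 * B / d * (b - a) + l"
    if t: "partition_points a b k t" for k t
  proof -
    have mono: "t i \<le> t j" if "i \<le> j" "j \<le> Suc k" for i j
      using that
    proof (induction j rule: dec_induct)
      case (step n)
      then have "t n < t (Suc n)" using t by (auto simp: partition_points_def)
      then show ?case using step by auto
    qed auto
    have mem: "t i \<in> {a..b}" if "i \<le> Suc k" for i
      using mono[of 0 i] mono[of i "Suc k"] that t by (auto simp: partition_points_def)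
    have "\<bar>f (t (Suc i)) - f (t i)\<bar> - l \<le> 2 * B / d * (t (Suc i) - t i)" if i: "i \<le> k" for i
    proof -
      have lt: "t i < t (Suc i)" using t i by (auto simp: partition_points_def)
      have ins: "t i \<in> {a..b}" "t (Suc i) \<in> {a..b}" using mem i by auto
      show ?thesis
      proof (cases "t (Suc i) - t i < d")
        case True
        then have "\<bar>f (t (Suc i)) - f (t i)\<bar> < l"
          using d(2)[OF ins] lt by (auto simp: dist_real_def)
        moreover have "2 * B / d * (t (Suc i) - t i) \<ge> 0" using B d lt by simp
        ultimately show ?thesis by linarith
      next
        case False
        then have "2 * B * d \<le> 2 * B * (t (Suc i) - t i)" using B by simp
        then have "2 * B \<le> 2 * B / d * (t (Suc i) - t i)" using d by (simp add: field_simps)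
        moreover have "\<bar>f (t (Suc i)) - f (t i)\<bar> \<le> 2 * B" using B(2)[OF ins(1)] B(2)[OF ins(2)] by linarith
        ultimately show ?thesis using \<open>l > 0\<close> by linarith
      qed
    qed
    then have "(\<Sum>i\<le>k. \<bar>f (t (Suc i)) - f (t i)\<bar> - l) \<le> (\<Sum>i\<le>k. 2 * B / d * (t (Suc i) - t i))"
      by (intro sum_mono) auto
    also have "\<dots> = 2 * B / d * (\<Sum>i\<le>k. t (Suc i) - t i)"
      by (simp only: sum_distrib_left)
    also have "(\<Sum>i\<le>k. t (Suc i) - t i) = b - a"
      using t sum_lessThan_telescope[of t "Suc k"]
      by (simp add: lessThan_Suc_atMost partition_points_def)
    finally show ?thesis by (simp add: sum_subtractf algebra_simps)
  qed
  then show ?thesis by (intro bdd_aboveI[where M = "2 * B / d * (b - a) + l"]) auto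
qed

text \<open>Standard Brownian motion on [0, T]. All sample paths are continuous, so that path
  functionals defined only for continuous functions make sense for every outcome. The
  second argument of \<^const>\<open>normal_density\<close> is the standard deviation.\<close>

locale standard_brownian_motion = prob_space M
  for M :: "'a measure" and T :: real and W :: "real \<Rightarrow> 'a \<Rightarrow> real" +
  assumes random_variable: "\<And>t. 0 \<le> t \<Longrightarrow> t \<le> T \<Longrightarrow> W t \<in> borel_measurable M"
    and start_zero: "AE \<omega> in M. W 0 \<omega> = 0"
    and continuous_paths: "\<And>\<omega>. \<omega> \<in> space M \<Longrightarrow> continuous_on {0..T} (\<lambda>t. W t \<omega>)"
    and gaussian_increments: "\<And>s t. 0 \<le> s \<Longrightarrow> s < t \<Longrightarrow> t \<le> T \<Longrightarrow>
      distributed M lborel (\<lambda>\<omega>. W t \<omega> - W s \<omega>) (\<lambda>x. ennreal (normal_density 0 (sqrt (t - s)) x))"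
    and independent_increments: "\<And>(n::nat) t. 0 \<le> t 0 \<Longrightarrow> t n \<le> T \<Longrightarrow>
      (\<forall>i<n. t i < t (Suc i)) \<Longrightarrow>
      indep_vars (\<lambda>_. borel) (\<lambda>i \<omega>. W (t (Suc i)) \<omega> - W (t i) \<omega>) {..<n}"

end

theory Submission imports Defs
begin

text \<open>Sample the path on the grid of mesh \<open>1 / n\<close> and split the resulting walk as \<open>h + g\<close>, where \<open>h\<close>
  (\<open>strip_walk\<close>) is the walk reflected in the strip \<open>[-l/2, l/2]\<close> and \<open>g\<close> collects the pushes needed to keep it there.
  The penalised variation restricted to grid points is exactly \<open>TV g + \<bar>h\<bar>\<close>: writing \<open>V\<close> for the
  variation of \<open>g\<close> so far (\<open>push_total\<close>), \<open>V + h\<close> and \<open>V - h\<close> are the best values of a partition whose current segment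
  is going up or down, and switching direction costs \<open>l\<close>. Pushes only happen at the boundary of the
  strip, so \<open>h\<^sup>2 + l * V\<close> grows in mean like the quadratic variation of the walk, up to the squares of the
  pushes, which vanish as \<open>n \<rightarrow> \<infinity>\<close>. Hence \<open>l * E V\<close> is close to \<open>1 - E h\<^sup>2\<close> for large \<open>n\<close>, and
  \<open>h\<^sup>2 \<le> l \<bar>h\<bar>\<close> gives the lower bound; the upper bound passes to the limit by Fatou's lemma.\<close>

section \<open>The reflected walk and its pushes\<close>

text \<open>The discrete two-sided Skorokhod map, driven by the increments \<open>x\<close> rather
  than by positions: overshoot is cut off, not mirrored. The width \<open>l\<close> of the strip is
  the price of one turn.\<close>

primrec strip_walk :: "real \<Rightarrow> (nat \<Rightarrow> real) \<Rightarrow> nat \<Rightarrow> real" where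
  "strip_walk l x 0 = 0"
| "strip_walk l x (Suc j) = max (- (l / 2)) (min (l / 2) (strip_walk l x j + x j))"

definition push :: "real \<Rightarrow> (nat \<Rightarrow> real) \<Rightarrow> nat \<Rightarrow> real" where
  "push l x j = strip_walk l x j + x j - strip_walk l x (Suc j)"

definition push_total :: "real \<Rightarrow> (nat \<Rightarrow> real) \<Rightarrow> nat \<Rightarrow> real" where
  "push_total l x n = (\<Sum>j<n. \<bar>push l x j\<bar>)"

text \<open>With \<open>V\<close> and \<open>h\<close> as above, this is the larger of
  \<open>V + h\<close> and \<open>V - h\<close>: the best value when the direction of the last
  segment is free.\<close>

definition zigzag_value :: "real \<Rightarrow> (nat \<Rightarrow> real) \<Rightarrow> nat \<Rightarrow> real" where
  "zigzag_value l x n = push_total l x n + \<bar>strip_walk l x n\<bar>"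

lemma push_total_simps [simp]:
  "push_total l x 0 = 0"
  "push_total l x (Suc n) = push_total l x n + \<bar>push l x n\<bar>"
  by (simp_all add: push_total_def)

lemma push_total_nonneg: "0 \<le> push_total l x n"
  by (simp add: push_total_def sum_nonneg)

lemma zigzag_value_nonneg: "0 \<le> zigzag_value l x n"
  by (simp add: zigzag_value_def push_total_nonneg)

lemma strip_walk_Suc_push: "strip_walk l x (Suc j) = strip_walk l x j + x j - push l x j"
  by (simp add: push_def)

lemma abs_strip_walk_le: "0 < l \<Longrightarrow> \<bar>strip_walk l x n\<bar> \<le> l / 2"
  by (cases n) (auto simp: abs_if max_def min_def)

lemma push_pos_imp: "push l x j > 0 \<Longrightarrow> 0 < l \<Longrightarrow> strip_walk l x (Suc j) = l / 2"
  by (auto simp: push_def)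

lemma push_neg_imp: "push l x j < 0 \<Longrightarrow> 0 < l \<Longrightarrow> strip_walk l x (Suc j) = - (l / 2)"
  by (auto simp: push_def)

text \<open>The walk starts the step inside the strip, so it cannot overshoot by more than the
  length of the step.\<close>

lemma abs_push_le: "0 < l \<Longrightarrow> \<bar>push l x j\<bar> \<le> \<bar>x j\<bar>"
  using abs_strip_walk_le[of l x j] by (auto simp: push_def)

text \<open>Write \<open>h\<close>, \<open>h'\<close> for the walk before and after the step and
  \<open>p\<close> for the push, and square \<open>h' + p = h + x\<close>. The cross term
  \<open>2 * h' * p\<close> is \<open>l * \<bar>p\<bar>\<close>, because a nonzero push leaves
  \<open>h'\<close> on the boundary, on the side of its sign.\<close>

lemma push_energy:
  assumes "0 < l"
  shows "l * \<bar>push l x j\<bar> = (strip_walk l x j)\<^sup>2 - (strip_walk l x (Suc j))\<^sup>2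
           + 2 * (strip_walk l x j * x j) + (x j)\<^sup>2 - (push l x j)\<^sup>2"
proof -
  have "l * \<bar>push l x j\<bar> = 2 * strip_walk l x (Suc j) * push l x j"
    using push_pos_imp[of l x j] push_neg_imp[of l x j] assms
    by (cases "push l x j" "0::real" rule: linorder_cases) (simp_all del: strip_walk.simps)
  moreover have "x j = strip_walk l x (Suc j) + push l x j - strip_walk l x j"
    by (simp add: push_def)
  ultimately show ?thesis
    by (simp only: power2_eq_square) (simp add: algebra_simps del: strip_walk.simps)
qed

text \<open>Truncation at \<open>e\<close>: a small push satisfies
  \<open>p\<^sup>2 \<le> e * \<bar>p\<bar>\<close>, a large one has
  \<open>e < \<bar>p\<bar> \<le> \<bar>x\<bar>\<close>. Fourth moments of Brownian grid increments
  are quadratic in the mesh, so the last term, summed over the grid, vanishes for fixed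
  \<open>e\<close>.\<close>

lemma push_square_le:
  assumes "0 < l" "0 < e"
  shows "(push l x j)\<^sup>2 \<le> e * \<bar>push l x j\<bar> + (x j) ^ 4 / e\<^sup>2"
proof (cases "\<bar>push l x j\<bar> \<le> e")
  case True
  then have "\<bar>push l x j\<bar> * \<bar>push l x j\<bar> \<le> e * \<bar>push l x j\<bar>"
    by (intro mult_right_mono) auto
  moreover have "0 \<le> (x j) ^ 4 / e\<^sup>2"
    by simp
  ultimately show ?thesis
    unfolding power2_abs[of "push l x j", symmetric] power2_eq_square[of "\<bar>push l x j\<bar>"] by linarith
next
  case False
  have le: "(push l x j)\<^sup>2 \<le> (x j)\<^sup>2"
    using abs_push_le[OF assms(1)] by (simp add: abs_le_square_iff)
  have "e\<^sup>2 \<le> (push l x j)\<^sup>2"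
    using False assms by (simp add: power2_le_iff_abs_le abs_le_square_iff[symmetric])
  with le have "e\<^sup>2 * (push l x j)\<^sup>2 \<le> (x j)\<^sup>2 * (x j)\<^sup>2"
    by (intro mult_mono) auto
  then have "(push l x j)\<^sup>2 \<le> (x j) ^ 4 / e\<^sup>2"
    using assms by (simp add: field_simps power2_eq_square power4_eq_xxxx)
  moreover have "0 \<le> e * \<bar>push l x j\<bar>"
    using assms by simp
  ultimately show ?thesis
    by linarith
qed

section \<open>Penalised variation over grid points\<close>

text \<open>After substituting \<open>h' = h + x - p\<close>, only
  \<open>\<sigma> * p \<le> \<bar>p\<bar>\<close> remains.\<close>

lemma push_total_signed_step:
  assumes "\<sigma> \<in> {1, -1}"
  shows "push_total l x j + \<sigma> * strip_walk l x j + \<sigma> * x j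
           \<le> push_total l x (Suc j) + \<sigma> * strip_walk l x (Suc j)"
  using assms by (auto simp: strip_walk_Suc_push simp del: strip_walk.simps)

lemma push_total_signed_mono:
  assumes "\<sigma> \<in> {1, -1}" "a \<le> b"
  shows "push_total l (\<lambda>j. s (Suc j) - s j) a + \<sigma> * strip_walk l (\<lambda>j. s (Suc j) - s j) a + \<sigma> * (s b - s a)
           \<le> push_total l (\<lambda>j. s (Suc j) - s j) b + \<sigma> * strip_walk l (\<lambda>j. s (Suc j) - s j) b"
  using assms(2)
proof (induction b rule: dec_induct)
  case (step b)
  then show ?case
    using push_total_signed_step[OF assms(1), of l "\<lambda>j. s (Suc j) - s j" b]
    by (simp add: algebra_simps del: strip_walk.simps push_total_simps)
qed simp

text \<open>Each segment raises \<open>V - \<bar>h\<bar>\<close> to at most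
  \<open>V + \<bar>h\<bar>\<close> at its end, and paying \<open>l \<ge> 2 * \<bar>h\<bar>\<close>
  for a turn leads back to \<open>V - \<bar>h\<bar>\<close>. Indices may repeat, since distinct
  times can round to the same grid point.\<close>

lemma grid_variation_le_zigzag_value:
  fixes m :: "nat \<Rightarrow> nat" and s :: "nat \<Rightarrow> real"
  assumes l: "0 < l" and m: "m 0 = 0" "\<And>i. i \<le> k \<Longrightarrow> m i \<le> m (Suc i)"
  shows "(\<Sum>i\<le>k. \<bar>s (m (Suc i)) - s (m i)\<bar>) - l * real k
           \<le> zigzag_value l (\<lambda>j. s (Suc j) - s j) (m (Suc k))"
proof -
  define V where "V = push_total l (\<lambda>j. s (Suc j) - s j)"
  define h where "h = strip_walk l (\<lambda>j. s (Suc j) - s j)"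
  \<comment> \<open>Take for \<open>\<sigma>\<close> the sign of \<open>s b - s a\<close>, then
    bound the signed values of \<open>h\<close> by their moduli.\<close>
  have step: "V a - \<bar>h a\<bar> + \<bar>s b - s a\<bar> \<le> V b + \<bar>h b\<bar>" if "a \<le> b" for a b
    using push_total_signed_mono[of 1 a b l s] push_total_signed_mono[of "-1" a b l s] that
    unfolding V_def h_def by (auto simp: abs_if split: if_splits)
  have hb: "\<bar>h a\<bar> \<le> l / 2" for a
    unfolding h_def by (rule abs_strip_walk_le[OF l])
  \<comment> \<open>Here every segment is followed by a penalty. The final segment is added
    afterwards without one, giving \<open>k\<close> penalties for \<open>k + 1\<close>
    segments.\<close>
  have inv: "(\<Sum>i<q. \<bar>s (m (Suc i)) - s (m i)\<bar>) - l * real q \<le> V (m q) - \<bar>h (m q)\<bar>" if "q \<le> k" for q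
    using that
  proof (induction q)
    case 0
    then show ?case by (simp add: m V_def h_def)
  next
    case (Suc q)
    then show ?case
      using step[OF m(2)[of q]] hb[of "m (Suc q)"] by (simp add: algebra_simps)
  qed
  show ?thesis
    using inv[of k] step[OF m(2)[of k]]
    by (simp add: zigzag_value_def V_def h_def flip: lessThan_Suc_atMost)
qed

text \<open>Since the partitions in question still have to be completed by a last point, the final
  increment is counted with a fixed sign instead of an absolute value.\<close>

lemma signed_partition_exists:
  fixes f :: "real \<Rightarrow> real" and \<tau> :: "nat \<Rightarrow> real"
  assumes l: "0 < l" and \<tau>: "\<And>i. \<tau> i < \<tau> (Suc i)" and \<sigma>: "\<sigma> \<in> {1, -1}"
  defines "x \<equiv> \<lambda>j. f (\<tau> (Suc j)) - f (\<tau> j)"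
  shows "\<exists>k t. t 0 = \<tau> 0 \<and> (\<forall>i<k. t i < t (Suc i)) \<and> t k \<le> \<tau> j \<and>
           push_total l x j + \<sigma> * strip_walk l x j
             \<le> (\<Sum>i<k. \<bar>f (t (Suc i)) - f (t i)\<bar>) + \<sigma> * (f (\<tau> j) - f (t k)) - l * real k"
  using \<sigma>
proof (induction j arbitrary: \<sigma>)
  case 0
  show ?case by (rule exI[of _ 0], rule exI[of _ "\<lambda>_. \<tau> 0"]) simp
next
  case (Suc j)
  note [simp del] = strip_walk.simps
  show ?case
  \<comment> \<open>The push decides whether the best partition turns: a push along
    \<open>\<sigma>\<close> continues the current segment, a push against it forces a turn.\<close>
  proof (cases "\<sigma> * push l x j \<ge> 0")
    case True
    then have "\<bar>push l x j\<bar> = \<sigma> * push l x j"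
      using Suc.prems by auto
    moreover obtain k t where "t 0 = \<tau> 0" "\<forall>i<k. t i < t (Suc i)" "t k \<le> \<tau> j"
      "push_total l x j + \<sigma> * strip_walk l x j
             \<le> (\<Sum>i<k. \<bar>f (t (Suc i)) - f (t i)\<bar>) + \<sigma> * (f (\<tau> j) - f (t k)) - l * real k"
      using Suc by blast
    ultimately show ?thesis
      using \<tau>[of j]
      by (intro exI[of _ k] exI[of _ t]) (simp add: strip_walk_Suc_push x_def algebra_simps)
  next
    case False
    then have p: "\<bar>push l x j\<bar> = - \<sigma> * push l x j"
      using Suc.prems by auto
    \<comment> \<open>The push goes against \<open>\<sigma>\<close>, so the walk sits on the
      opposite boundary. There the values for \<open>\<sigma>\<close> and \<open>- \<sigma>\<close>
      differ by exactly \<open>l\<close>, which pays for a turn after a segment in direction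
      \<open>- \<sigma>\<close>.\<close>
    have h: "\<sigma> * strip_walk l x (Suc j) = - (l / 2)"
      using False Suc.prems push_pos_imp[of l x j] push_neg_imp[of l x j] l by auto
    have "- \<sigma> \<in> {1, -1}"
      using Suc.prems by auto
    from Suc.IH[OF this] obtain k t where kt: "t 0 = \<tau> 0" "\<forall>i<k. t i < t (Suc i)" "t k \<le> \<tau> j"
      "push_total l x j + - \<sigma> * strip_walk l x j
             \<le> (\<Sum>i<k. \<bar>f (t (Suc i)) - f (t i)\<bar>) + - \<sigma> * (f (\<tau> j) - f (t k)) - l * real k"
      by blast
    \<comment> \<open>The turn is placed at the current grid point, so the signed increment after it
      is still zero.\<close>
    define t' where "t' = t(Suc k := \<tau> (Suc j))"
    have sums: "(\<Sum>i<k. \<bar>f (t' (Suc i)) - f (t' i)\<bar>) = (\<Sum>i<k. \<bar>f (t (Suc i)) - f (t i)\<bar>)"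
      by (intro sum.cong) (auto simp: t'_def)
    have incr: "- \<sigma> * (f (\<tau> (Suc j)) - f (t k)) \<le> \<bar>f (\<tau> (Suc j)) - f (t k)\<bar>"
      using Suc.prems by auto
    have "push_total l x (Suc j) + \<sigma> * strip_walk l x (Suc j)
        = push_total l x j + (- \<sigma>) * strip_walk l x j - \<sigma> * x j - l"
    proof -
      have "\<sigma> * strip_walk l x (Suc j) = - (\<sigma> * strip_walk l x (Suc j)) - l"
        using h by simp
      then show ?thesis
        using p by (simp add: strip_walk_Suc_push algebra_simps)
    qed
    also have "\<dots> \<le> (\<Sum>i<Suc k. \<bar>f (t' (Suc i)) - f (t' i)\<bar>)
          + \<sigma> * (f (\<tau> (Suc j)) - f (t' (Suc k))) - l * real (Suc k)"
      using kt(4) incr sums by (simp add: t'_def x_def algebra_simps)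
    finally show ?thesis
      using kt(1-3) \<tau>[of j]
      by (intro exI[of _ "Suc k"] exI[of _ t']) (auto simp: t'_def less_Suc_eq)
  qed
qed

lemma reg_total_variation_upper:
  assumes "a < b" "0 < l" "continuous_on {a..b} f" "partition_points a b k t"
  shows "(\<Sum>i\<le>k. \<bar>f (t (Suc i)) - f (t i)\<bar>) - l * real k \<le> reg_total_variation a b l f"
  unfolding reg_total_variation_def
  using reg_total_variation_bdd_above[OF assms(1-3)] assms(4) by (intro cSup_upper) auto

text \<open>The signed construction is stopped one grid point early: its last point is then strictly
  before \<open>\<tau> (Suc n)\<close>, which can be appended to close the partition.\<close>

lemma zigzag_value_le_reg_total_variation:
  fixes f :: "real \<Rightarrow> real" and \<tau> :: "nat \<Rightarrow> real"
  assumes l: "0 < l" and \<tau>: "\<And>i. \<tau> i < \<tau> (Suc i)"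
    and cont: "continuous_on {\<tau> 0..\<tau> (Suc n)} f"
  shows "zigzag_value l (\<lambda>j. f (\<tau> (Suc j)) - f (\<tau> j)) (Suc n)
           \<le> reg_total_variation (\<tau> 0) (\<tau> (Suc n)) l f"
proof -
  define x where "x = (\<lambda>j. f (\<tau> (Suc j)) - f (\<tau> j))"
  define \<sigma> :: real where "\<sigma> = (if strip_walk l x (Suc n) \<ge> 0 then 1 else -1)"
  note [simp del] = strip_walk.simps
  have \<sigma>: "\<sigma> \<in> {1, -1}"
    by (simp add: \<sigma>_def)
  \<comment> \<open>A nonzero last push leaves the walk on the boundary of its own sign, and
    \<open>\<sigma>\<close> is the sign of that final position. Hence the last step only adds
    \<open>\<sigma> * x n\<close>.\<close>
  have "\<bar>push l x n\<bar> = \<sigma> * push l x n"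
    using push_pos_imp[of l x n] push_neg_imp[of l x n] l
    by (cases "push l x n" "0::real" rule: linorder_cases) (auto simp: \<sigma>_def)
  moreover have "\<bar>strip_walk l x (Suc n)\<bar> = \<sigma> * strip_walk l x (Suc n)"
    by (simp add: \<sigma>_def)
  ultimately have eq: "zigzag_value l x (Suc n) = push_total l x n + \<sigma> * strip_walk l x n + \<sigma> * x n"
    by (simp add: zigzag_value_def strip_walk_Suc_push algebra_simps)
  obtain k t where kt: "t 0 = \<tau> 0" "\<forall>i<k. t i < t (Suc i)" "t k \<le> \<tau> n"
      "push_total l x n + \<sigma> * strip_walk l x n
             \<le> (\<Sum>i<k. \<bar>f (t (Suc i)) - f (t i)\<bar>) + \<sigma> * (f (\<tau> n) - f (t k)) - l * real k"
    using signed_partition_exists[where \<tau>=\<tau> and f=f and \<sigma>=\<sigma> and j=n, OF l \<tau> \<sigma>] unfolding x_def by blast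
  define t' where "t' = t(Suc k := \<tau> (Suc n))"
  have part: "partition_points (\<tau> 0) (\<tau> (Suc n)) k t'"
    using kt(1-3) \<tau>[of n] by (auto simp: partition_points_def t'_def)
  have sums: "(\<Sum>i<k. \<bar>f (t' (Suc i)) - f (t' i)\<bar>) = (\<Sum>i<k. \<bar>f (t (Suc i)) - f (t i)\<bar>)"
    by (intro sum.cong) (auto simp: t'_def)
  have incr: "\<sigma> * (f (\<tau> (Suc n)) - f (t k)) \<le> \<bar>f (\<tau> (Suc n)) - f (t k)\<bar>"
    using \<sigma> by auto
  have "zigzag_value l x (Suc n) \<le> (\<Sum>i\<le>k. \<bar>f (t' (Suc i)) - f (t' i)\<bar>) - l * real k"
    unfolding eq lessThan_Suc_atMost[symmetric]
    using kt(4) incr sums by (simp add: t'_def x_def algebra_simps)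
  also have "\<dots> \<le> reg_total_variation (\<tau> 0) (\<tau> (Suc n)) l f"
    using strict_mono_Suc_iff[of \<tau>] \<tau>
    by (intro reg_total_variation_upper[OF _ l cont part]) (auto simp: strict_mono_def)
  finally show ?thesis
    by (simp add: x_def)
qed

section \<open>Refining the grid and passing to the limit\<close>

lemma tendsto_grid_floor:
  fixes u :: real
  assumes "0 \<le> u"
  shows "(\<lambda>n. real (nat \<lfloor>real (Suc n) * u\<rfloor>) / real (Suc n)) \<longlonglongrightarrow> u"
proof (rule tendsto_sandwich)
  show "(\<lambda>n. u - inverse (real (Suc n))) \<longlonglongrightarrow> u"
    using tendsto_diff[OF tendsto_const LIMSEQ_inverse_real_of_nat] by simp
  show "\<forall>\<^sub>F n in sequentially. u - inverse (real (Suc n)) \<le> real (nat \<lfloor>real (Suc n) * u\<rfloor>) / real (Suc n)"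
  proof (intro always_eventually allI)
    fix n
    have "u * real (Suc n) - 1 \<le> real (nat \<lfloor>real (Suc n) * u\<rfloor>)"
      using assms by (simp add: mult.commute)
    then show "u - inverse (real (Suc n)) \<le> real (nat \<lfloor>real (Suc n) * u\<rfloor>) / real (Suc n)"
      by (simp add: pos_le_divide_eq left_diff_distrib del: of_nat_Suc)
  qed
  show "\<forall>\<^sub>F n in sequentially. real (nat \<lfloor>real (Suc n) * u\<rfloor>) / real (Suc n) \<le> u"
  proof (intro always_eventually allI)
    fix n
    have "real (nat \<lfloor>real (Suc n) * u\<rfloor>) \<le> u * real (Suc n)"
      using of_nat_floor[of "real (Suc n) * u"] assms by (simp add: mult.commute)
    then show "real (nat \<lfloor>real (Suc n) * u\<rfloor>) / real (Suc n) \<le> u"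
      by (simp add: pos_divide_le_eq del: of_nat_Suc)
  qed
qed (rule tendsto_const)

definition grid_increment :: "(real \<Rightarrow> real) \<Rightarrow> nat \<Rightarrow> nat \<Rightarrow> real" where
  "grid_increment f n j = f (real (Suc j) / real n) - f (real j / real n)"

lemma zigzag_value_grid_le:
  assumes "0 < l" "continuous_on {0..1} f"
  shows "zigzag_value l (grid_increment f (Suc n)) (Suc n) \<le> reg_total_variation 0 1 l f"
proof -
  have "real i / real (Suc n) < real (Suc i) / real (Suc n)" for i
    by (intro divide_strict_right_mono) auto
  then show ?thesis
    using zigzag_value_le_reg_total_variation[of l "\<lambda>i. real i / real (Suc n)" n f] assms
    by (simp add: grid_increment_def[abs_def])
qed

text \<open>Grid values never exceed the supremum. Conversely, a fixed partition with value above
  \<open>c\<close> is rounded down to the grid; by continuity its value converges, and every rounded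
  value is dominated by the zigzag value.\<close>

lemma zigzag_value_grid_tendsto:
  assumes l: "0 < l" and cont: "continuous_on {0..1} f"
  shows "(\<lambda>n. zigzag_value l (grid_increment f (Suc n)) (Suc n)) \<longlonglongrightarrow> reg_total_variation 0 1 l f"
proof (rule order_tendstoI)
  fix c assume "c > reg_total_variation 0 1 l f"
  then show "\<forall>\<^sub>F n in sequentially. zigzag_value l (grid_increment f (Suc n)) (Suc n) < c"
    using zigzag_value_grid_le[OF l cont] by (intro always_eventually) (auto intro: le_less_trans)
next
  fix c assume "c < reg_total_variation 0 1 l f"
  then obtain k t where t: "partition_points 0 1 k t"
    and c: "c < (\<Sum>i\<le>k. \<bar>f (t (Suc i)) - f (t i)\<bar>) - l * real k"
    unfolding reg_total_variation_def
    using reg_total_variation_bdd_above[OF _ l cont] reg_total_variation_nonempty[of 0 1 f l]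
    by (subst (asm) less_cSup_iff) auto
  have mono: "t i \<le> t j" if "i \<le> j" "j \<le> Suc k" for i j
    using that
  proof (induction j rule: dec_induct)
    case (step n)
    then have "t n < t (Suc n)" using t by (auto simp: partition_points_def)
    then show ?case using step by auto
  qed auto
  have mem: "t i \<in> {0..1}" if "i \<le> Suc k" for i
    using mono[of 0 i] mono[of i "Suc k"] that t by (auto simp: partition_points_def)
  define m where "m n i = nat \<lfloor>real (Suc n) * t i\<rfloor>" for n i
  define s where "s n j = f (real j / real (Suc n))" for n j
  have lim: "(\<lambda>n. s n (m n i)) \<longlonglongrightarrow> f (t i)" if i: "i \<le> Suc k" for i
  proof -
    have "real (m n i) / real (Suc n) \<in> {0..1}" for n
    proof -
      have "real (m n i) \<le> real (Suc n)"
        using mem[OF i] mult_left_le[of "t i" "real (Suc n)"] of_nat_floor[of "real (Suc n) * t i"]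
        unfolding m_def by (simp only: atLeastAtMost_iff) (meson mult_nonneg_nonneg of_nat_0_le_iff order_trans)
      then show ?thesis by simp
    qed
    then show ?thesis
      using cont mem[OF i] tendsto_grid_floor[of "t i"] unfolding s_def m_def
      by (intro continuous_on_tendsto_compose[OF cont]) auto
  qed
  have "(\<lambda>n. (\<Sum>i\<le>k. \<bar>s n (m n (Suc i)) - s n (m n i)\<bar>) - l * real k)
      \<longlonglongrightarrow> (\<Sum>i\<le>k. \<bar>f (t (Suc i)) - f (t i)\<bar>) - l * real k"
    by (intro tendsto_intros lim) auto
  then have "\<forall>\<^sub>F n in sequentially. c < (\<Sum>i\<le>k. \<bar>s n (m n (Suc i)) - s n (m n i)\<bar>) - l * real k"
    using c by (rule order_tendstoD(1))
  then show "\<forall>\<^sub>F n in sequentially. c < zigzag_value l (grid_increment f (Suc n)) (Suc n)"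
  proof (eventually_elim)
    case (elim n)
    \<comment> \<open>The endpoints 0 and 1 are grid points, so rounding leaves them fixed and the
      sampled path runs over the whole grid.\<close>
    have "m n 0 = 0" "m n (Suc k) = Suc n"
      using t by (simp_all add: m_def partition_points_def nat_add_distrib)
    moreover have "m n i \<le> m n (Suc i)" if "i \<le> k" for i
      unfolding m_def using mono[of i "Suc i"] that by (intro nat_mono floor_mono mult_left_mono) auto
    ultimately have "(\<Sum>i\<le>k. \<bar>s n (m n (Suc i)) - s n (m n i)\<bar>) - l * real k
        \<le> zigzag_value l (\<lambda>j. s n (Suc j) - s n j) (Suc n)"
      using grid_variation_le_zigzag_value[OF l, of "m n" k "s n"] by simp
    with elim show ?case
      by (simp add: s_def grid_increment_def[abs_def])
  qed
qed

text \<open>Fatou's lemma, with a nonnegative integral because integrability of the limit is one of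
  the things to be derived from it.\<close>

lemma nn_integral_lim_le:
  fixes u :: "nat \<Rightarrow> 'a \<Rightarrow> real"
  assumes "\<And>n. integrable M (u n)" "\<And>n \<omega>. 0 \<le> u n \<omega>"
    and "\<And>\<omega>. \<omega> \<in> space M \<Longrightarrow> (\<lambda>n. u n \<omega>) \<longlonglongrightarrow> g \<omega>"
    and "\<And>n. integral\<^sup>L M (u n) \<le> C"
  shows "(\<integral>\<^sup>+\<omega>. ennreal (g \<omega>) \<partial>M) \<le> ennreal C"
proof -
  have "(\<integral>\<^sup>+\<omega>. ennreal (g \<omega>) \<partial>M) = (\<integral>\<^sup>+\<omega>. liminf (\<lambda>n. ennreal (u n \<omega>)) \<partial>M)"
    using assms(3) by (intro nn_integral_cong) (auto intro!: lim_imp_Liminf[symmetric] tendsto_ennrealI)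
  also have "\<dots> \<le> liminf (\<lambda>n. \<integral>\<^sup>+\<omega>. ennreal (u n \<omega>) \<partial>M)"
    using assms(1) by (intro nn_integral_liminf) auto
  also have "\<dots> \<le> ennreal C"
    using assms by (intro Liminf_le always_eventually allI)
      (simp_all add: nn_integral_eq_integral ennreal_leI)
  finally show ?thesis .
qed

section \<open>Mean values for independent centred increments\<close>

context prob_space
begin

text \<open>For Brownian increments on a grid of \<open>n\<close> steps, \<open>v = 1 / n\<close>
  and \<open>w = 3 / n\<^sup>2\<close>, so that \<open>n * v = 1\<close> while \<open>n * w\<close>
  tends to 0.\<close>

context
  fixes X :: "nat \<Rightarrow> 'a \<Rightarrow> real" and n :: nat and l v w :: real
  assumes l: "0 < l"
    and indep: "indep_vars (\<lambda>_. borel) X {..<n}"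
    and int1: "\<And>j. j < n \<Longrightarrow> integrable M (X j)"
    and int2: "\<And>j. j < n \<Longrightarrow> integrable M (\<lambda>\<omega>. (X j \<omega>)\<^sup>2)"
    and int4: "\<And>j. j < n \<Longrightarrow> integrable M (\<lambda>\<omega>. (X j \<omega>) ^ 4)"
    and mean: "\<And>j. j < n \<Longrightarrow> expectation (X j) = 0"
    and moment2: "\<And>j. j < n \<Longrightarrow> expectation (\<lambda>\<omega>. (X j \<omega>)\<^sup>2) = v"
    and moment4: "\<And>j. j < n \<Longrightarrow> expectation (\<lambda>\<omega>. (X j \<omega>) ^ 4) = w"
begin

lemma measurable_strip_walk [measurable]:
  assumes "j \<le> n"
  shows "(\<lambda>\<omega>. strip_walk l (\<lambda>i. X i \<omega>) j) \<in> borel_measurable M"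
  using assms
proof (induction j)
  case (Suc j)
  then have [measurable]: "(\<lambda>\<omega>. strip_walk l (\<lambda>i. X i \<omega>) j) \<in> borel_measurable M"
    "X j \<in> borel_measurable M"
    using int1[of j] by auto
  show ?case by simp
qed simp

lemma measurable_push [measurable]:
  assumes "j < n"
  shows "(\<lambda>\<omega>. push l (\<lambda>i. X i \<omega>) j) \<in> borel_measurable M"
proof -
  have [measurable]: "X j \<in> borel_measurable M"
    using int1[OF assms] by auto
  show ?thesis
    unfolding push_def
    using measurable_strip_walk[of j] measurable_strip_walk[of "Suc j"] assms
    by (intro borel_measurable_add borel_measurable_diff) auto
qed

lemma integrable_strip_walk:
  assumes "j \<le> n"
  shows "integrable M (\<lambda>\<omega>. strip_walk l (\<lambda>i. X i \<omega>) j)"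
  using abs_strip_walk_le[OF l] measurable_strip_walk[OF assms]
  by (intro integrable_const_bound[where B = "l / 2"]) auto

lemma integrable_strip_walk_square:
  assumes "j \<le> n"
  shows "integrable M (\<lambda>\<omega>. (strip_walk l (\<lambda>i. X i \<omega>) j)\<^sup>2)"
proof -
  have "\<bar>strip_walk l (\<lambda>i. X i \<omega>) j\<bar> ^ 2 \<le> (l / 2)\<^sup>2" for \<omega>
    using abs_strip_walk_le[OF l] by (intro power_mono) auto
  then show ?thesis
    using measurable_strip_walk[OF assms]
    by (intro integrable_const_bound[where B = "(l / 2)\<^sup>2"]) auto
qed

lemma integrable_push:
  assumes "j < n"
  shows "integrable M (\<lambda>\<omega>. \<bar>push l (\<lambda>i. X i \<omega>) j\<bar>)"
  using int1[OF assms] measurable_push[OF assms]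
  by (rule Bochner_Integration.integrable_bound[OF _ borel_measurable_abs]) (auto intro!: abs_push_le[OF l])

lemma integrable_push_square:
  assumes "j < n"
  shows "integrable M (\<lambda>\<omega>. (push l (\<lambda>i. X i \<omega>) j)\<^sup>2)"
  using int2[OF assms] measurable_push[OF assms]
  by (rule Bochner_Integration.integrable_bound[OF _ borel_measurable_power])
    (auto intro!: abs_push_le[OF l] simp: abs_le_square_iff[symmetric])

text \<open>The walk at time \<open>j\<close> depends on the increments before \<open>j\<close>
  only, hence is independent of the centred variable \<open>X j\<close>.\<close>

lemma strip_walk_increment_uncorrelated:
  assumes j: "j < n"
  shows "integrable M (\<lambda>\<omega>. strip_walk l (\<lambda>i. X i \<omega>) j * X j \<omega>)"
    and "expectation (\<lambda>\<omega>. strip_walk l (\<lambda>i. X i \<omega>) j * X j \<omega>) = 0"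
proof -
  have meas: "(\<lambda>x. strip_walk l x i) \<in> borel_measurable (PiM {..<j} (\<lambda>_. borel))" if "i \<le> j" for i
    using that
  proof (induction i)
    case (Suc i)
    then have [measurable]: "(\<lambda>x. strip_walk l x i) \<in> borel_measurable (PiM {..<j} (\<lambda>_. borel))"
      "(\<lambda>x. x i) \<in> borel_measurable (PiM {..<j} (\<lambda>_. borel :: real measure))"
      by auto
    show ?case by simp
  qed simp
  \<comment> \<open>Restriction makes the coordinates from \<open>j\<close> on
    \<open>undefined\<close>; the walk up to time \<open>j\<close> never reads them.\<close>
  have restrict: "strip_walk l (restrict x {..<j}) i = strip_walk l x i" if "i \<le> j" for i x
    using that by (induction i) auto
  have "indep_var (PiM {..<j} (\<lambda>_. borel)) (\<lambda>\<omega>. restrict (\<lambda>i. X i \<omega>) {..<j})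
      (PiM {j} (\<lambda>_. borel)) (\<lambda>\<omega>. restrict (\<lambda>i. X i \<omega>) {j})"
    using j by (intro indep_var_restrict[OF indep]) auto
  then have "indep_var borel ((\<lambda>x. strip_walk l x j) \<circ> (\<lambda>\<omega>. restrict (\<lambda>i. X i \<omega>) {..<j}))
      borel ((\<lambda>x. x j) \<circ> (\<lambda>\<omega>. restrict (\<lambda>i. X i \<omega>) {j}))"
    using meas by (rule indep_var_compose) auto
  then have ind: "indep_var borel (\<lambda>\<omega>. strip_walk l (\<lambda>i. X i \<omega>) j) borel (X j)"
    by (simp add: comp_def restrict)
  have int: "integrable M (\<lambda>\<omega>. strip_walk l (\<lambda>i. X i \<omega>) j)"
    using j by (intro integrable_strip_walk) auto
  show "integrable M (\<lambda>\<omega>. strip_walk l (\<lambda>i. X i \<omega>) j * X j \<omega>)"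
    by (rule indep_var_integrable[OF ind int int1[OF j]])
  show "expectation (\<lambda>\<omega>. strip_walk l (\<lambda>i. X i \<omega>) j * X j \<omega>) = 0"
    by (subst indep_var_lebesgue_integral[OF ind int int1[OF j]]) (simp add: mean[OF j])
qed

lemma integrable_push_total: "integrable M (\<lambda>\<omega>. push_total l (\<lambda>i. X i \<omega>) n)"
  unfolding push_total_def using integrable_push by (intro Bochner_Integration.integrable_sum) auto

lemma integrable_zigzag_value: "integrable M (\<lambda>\<omega>. zigzag_value l (\<lambda>i. X i \<omega>) n)"
  unfolding zigzag_value_def using integrable_push_total integrable_strip_walk by auto

text \<open>The mean of \<open>push_energy\<close>: the cross term drops out as walk and increment
  are uncorrelated.\<close>

lemma expectation_abs_push:
  assumes j: "j < n"
  shows "l * expectation (\<lambda>\<omega>. \<bar>push l (\<lambda>i. X i \<omega>) j\<bar>)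
    = expectation (\<lambda>\<omega>. (strip_walk l (\<lambda>i. X i \<omega>) j)\<^sup>2)
      - expectation (\<lambda>\<omega>. (strip_walk l (\<lambda>i. X i \<omega>) (Suc j))\<^sup>2)
      + v - expectation (\<lambda>\<omega>. (push l (\<lambda>i. X i \<omega>) j)\<^sup>2)"
proof -
  note [simp del] = strip_walk.simps
  have [simp]: "integrable M (\<lambda>\<omega>. (strip_walk l (\<lambda>i. X i \<omega>) j)\<^sup>2)"
    "integrable M (\<lambda>\<omega>. (strip_walk l (\<lambda>i. X i \<omega>) (Suc j))\<^sup>2)"
    "integrable M (\<lambda>\<omega>. (push l (\<lambda>i. X i \<omega>) j)\<^sup>2)"
    using j by (auto intro: integrable_strip_walk_square integrable_push_square)
  note [simp] = strip_walk_increment_uncorrelated[OF j] int2[OF j] moment2[OF j]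
  have "l * expectation (\<lambda>\<omega>. \<bar>push l (\<lambda>i. X i \<omega>) j\<bar>)
      = expectation (\<lambda>\<omega>. l * \<bar>push l (\<lambda>i. X i \<omega>) j\<bar>)"
    by simp
  also have "\<dots> = expectation (\<lambda>\<omega>. (strip_walk l (\<lambda>i. X i \<omega>) j)\<^sup>2 - (strip_walk l (\<lambda>i. X i \<omega>) (Suc j))\<^sup>2
      + 2 * (strip_walk l (\<lambda>i. X i \<omega>) j * X j \<omega>) + (X j \<omega>)\<^sup>2 - (push l (\<lambda>i. X i \<omega>) j)\<^sup>2)"
    by (simp only: push_energy[OF l])
  also have "\<dots> = expectation (\<lambda>\<omega>. (strip_walk l (\<lambda>i. X i \<omega>) j)\<^sup>2)
      - expectation (\<lambda>\<omega>. (strip_walk l (\<lambda>i. X i \<omega>) (Suc j))\<^sup>2)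
      + v - expectation (\<lambda>\<omega>. (push l (\<lambda>i. X i \<omega>) j)\<^sup>2)"
    by simp
  finally show ?thesis .
qed

lemma expectation_push_total:
  "expectation (\<lambda>\<omega>. push_total l (\<lambda>i. X i \<omega>) n)
     = (\<Sum>j<n. expectation (\<lambda>\<omega>. \<bar>push l (\<lambda>i. X i \<omega>) j\<bar>))"
  unfolding push_total_def using integrable_push
  by (intro Bochner_Integration.integral_sum) auto

lemma expectation_push_total_energy:
  "l * expectation (\<lambda>\<omega>. push_total l (\<lambda>i. X i \<omega>) n)
     = real n * v - expectation (\<lambda>\<omega>. (strip_walk l (\<lambda>i. X i \<omega>) n)\<^sup>2)
       - (\<Sum>j<n. expectation (\<lambda>\<omega>. (push l (\<lambda>i. X i \<omega>) j)\<^sup>2))"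
proof -
  let ?H = "\<lambda>j. expectation (\<lambda>\<omega>. (strip_walk l (\<lambda>i. X i \<omega>) j)\<^sup>2)"
  let ?P = "\<lambda>j. expectation (\<lambda>\<omega>. (push l (\<lambda>i. X i \<omega>) j)\<^sup>2)"
  have "l * expectation (\<lambda>\<omega>. push_total l (\<lambda>i. X i \<omega>) n) = (\<Sum>j<n. (?H j - ?H (Suc j)) + v - ?P j)"
    unfolding expectation_push_total sum_distrib_left
    by (intro sum.cong refl expectation_abs_push) auto
  also have "\<dots> = (\<Sum>j<n. ?H j - ?H (Suc j)) + real n * v - (\<Sum>j<n. ?P j)"
    by (simp only: sum.distrib sum_subtractf) simp
  \<comment> \<open>The telescoping sum has no initial term because the walk starts at 0.\<close>
  also have "(\<Sum>j<n. ?H j - ?H (Suc j)) = - ?H n"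
    by (subst sum_lessThan_telescope') simp
  finally show ?thesis by simp
qed

lemma expectation_push_square_le:
  assumes j: "j < n" and e: "0 < e"
  shows "expectation (\<lambda>\<omega>. (push l (\<lambda>i. X i \<omega>) j)\<^sup>2)
           \<le> e * expectation (\<lambda>\<omega>. \<bar>push l (\<lambda>i. X i \<omega>) j\<bar>) + w / e\<^sup>2"
proof -
  have "expectation (\<lambda>\<omega>. (push l (\<lambda>i. X i \<omega>) j)\<^sup>2)
      \<le> expectation (\<lambda>\<omega>. e * \<bar>push l (\<lambda>i. X i \<omega>) j\<bar> + (X j \<omega>) ^ 4 / e\<^sup>2)"
    using integrable_push[OF j] int4[OF j]
    by (intro integral_mono integrable_push_square[OF j] push_square_le[OF l e]
        Bochner_Integration.integrable_add) auto
  also have "\<dots> = e * expectation (\<lambda>\<omega>. \<bar>push l (\<lambda>i. X i \<omega>) j\<bar>) + w / e\<^sup>2"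
    using integrable_push[OF j] int4[OF j] by (simp add: moment4[OF j])
  finally show ?thesis .
qed

lemma expectation_zigzag_value:
  "expectation (\<lambda>\<omega>. zigzag_value l (\<lambda>i. X i \<omega>) n)
     = expectation (\<lambda>\<omega>. push_total l (\<lambda>i. X i \<omega>) n)
       + expectation (\<lambda>\<omega>. \<bar>strip_walk l (\<lambda>i. X i \<omega>) n\<bar>)"
  unfolding zigzag_value_def using integrable_push_total integrable_strip_walk by simp

lemma expectation_push_total_le: "l * expectation (\<lambda>\<omega>. push_total l (\<lambda>i. X i \<omega>) n) \<le> real n * v"
proof -
  have "0 \<le> expectation (\<lambda>\<omega>. (strip_walk l (\<lambda>i. X i \<omega>) n)\<^sup>2)"
    "0 \<le> (\<Sum>j<n. expectation (\<lambda>\<omega>. (push l (\<lambda>i. X i \<omega>) j)\<^sup>2))"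
    by (auto intro!: sum_nonneg integral_nonneg)
  then show ?thesis
    unfolding expectation_push_total_energy by linarith
qed

text \<open>The pushes contribute at most \<open>n * v / l\<close> and the final position at most
  \<open>l / 2\<close>.\<close>

lemma expectation_zigzag_value_le:
  "expectation (\<lambda>\<omega>. zigzag_value l (\<lambda>i. X i \<omega>) n) \<le> real n * v / l + l"
proof -
  have "expectation (\<lambda>\<omega>. \<bar>strip_walk l (\<lambda>i. X i \<omega>) n\<bar>) \<le> expectation (\<lambda>\<omega>. l / 2)"
    using integrable_strip_walk[of n] abs_strip_walk_le[OF l] by (intro integral_mono) auto
  moreover have "expectation (\<lambda>\<omega>. push_total l (\<lambda>i. X i \<omega>) n) \<le> real n * v / l"
    using expectation_push_total_le l by (simp add: pos_le_divide_eq mult.commute)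
  ultimately show ?thesis
    using l unfolding expectation_zigzag_value by (simp add: prob_space)
qed

text \<open>In the energy balance the loss \<open>h\<^sup>2\<close> is compensated by the term
  \<open>l * \<bar>h\<bar>\<close> of the zigzag value. The squared pushes are truncated at
  \<open>e\<close>, and the upper bound on the mean total push controls the part proportional to
  \<open>e\<close>.\<close>

lemma expectation_zigzag_value_ge:
  assumes e: "0 < e"
  shows "real n * v - e * (real n * v / l) - real n * w / e\<^sup>2
           \<le> l * expectation (\<lambda>\<omega>. zigzag_value l (\<lambda>i. X i \<omega>) n)"
proof -
  have "(strip_walk l (\<lambda>i. X i \<omega>) n)\<^sup>2 \<le> l * \<bar>strip_walk l (\<lambda>i. X i \<omega>) n\<bar>" for \<omega>
  proof -
    have "\<bar>strip_walk l (\<lambda>i. X i \<omega>) n\<bar> * \<bar>strip_walk l (\<lambda>i. X i \<omega>) n\<bar> \<le> l * \<bar>strip_walk l (\<lambda>i. X i \<omega>) n\<bar>"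
      using abs_strip_walk_le[OF l, of "\<lambda>i. X i \<omega>" n] l by (intro mult_right_mono) auto
    then show ?thesis by (simp add: power2_eq_square)
  qed
  then have "expectation (\<lambda>\<omega>. (strip_walk l (\<lambda>i. X i \<omega>) n)\<^sup>2)
      \<le> expectation (\<lambda>\<omega>. l * \<bar>strip_walk l (\<lambda>i. X i \<omega>) n\<bar>)"
    using integrable_strip_walk[of n] integrable_strip_walk_square[of n] by (intro integral_mono) auto
  moreover have "(\<Sum>j<n. expectation (\<lambda>\<omega>. (push l (\<lambda>i. X i \<omega>) j)\<^sup>2))
      \<le> (\<Sum>j<n. e * expectation (\<lambda>\<omega>. \<bar>push l (\<lambda>i. X i \<omega>) j\<bar>) + w / e\<^sup>2)"
    using expectation_push_square_le[OF _ e] by (intro sum_mono) auto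
  moreover have "\<dots> = e * expectation (\<lambda>\<omega>. push_total l (\<lambda>i. X i \<omega>) n) + real n * w / e\<^sup>2"
    by (simp add: expectation_push_total sum.distrib sum_distrib_left)
  moreover have "e * expectation (\<lambda>\<omega>. push_total l (\<lambda>i. X i \<omega>) n) \<le> e * (real n * v / l)"
    using expectation_push_total_le l e by (simp add: pos_le_divide_eq mult.commute)
  ultimately show ?thesis
    using expectation_push_total_energy unfolding expectation_zigzag_value
    by (simp add: distrib_left)
qed

end

section \<open>Gaussian increments and Brownian motion\<close>

lemma centred_normal_moments:
  assumes \<sigma>: "0 < \<sigma>" and D: "distributed M lborel X (normal_density 0 \<sigma>)"
  shows "integrable M (\<lambda>\<omega>. X \<omega> ^ k)"
    and "expectation X = 0"
    and "expectation (\<lambda>\<omega>. (X \<omega>)\<^sup>2) = \<sigma>\<^sup>2"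
    and "expectation (\<lambda>\<omega>. X \<omega> ^ 4) = 3 * \<sigma> ^ 4"
proof -
  show "integrable M (\<lambda>\<omega>. X \<omega> ^ k)"
    using integrable_normal_moment[OF \<sigma>, of 0 k]
    by (subst distributed_integrable[OF D, symmetric]) auto
  show "expectation X = 0"
    by (rule normal_distributed_expectation[OF \<sigma> D])
  show "expectation (\<lambda>\<omega>. (X \<omega>)\<^sup>2) = \<sigma>\<^sup>2"
    using integral_normal_moment_even[OF \<sigma>, of 0 1]
    by (subst distributed_integral[OF D, symmetric]) auto
  show "expectation (\<lambda>\<omega>. X \<omega> ^ 4) = 3 * \<sigma> ^ 4"
    using integral_normal_moment_even[OF \<sigma>, of 0 2] \<sigma>
    by (subst distributed_integral[OF D, symmetric])
      (auto simp: fact_numeral field_simps power2_eq_square power4_eq_xxxx)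
qed

end

context standard_brownian_motion
begin

lemma grid_increment_indep:
  assumes "T = 1"
  shows "indep_vars (\<lambda>_. borel) (\<lambda>j \<omega>. grid_increment (\<lambda>t. W t \<omega>) (Suc n) j) {..<Suc n}"
  unfolding grid_increment_def
  using assms by (intro independent_increments[of "\<lambda>i. real i / real (Suc n)" "Suc n"])
    (auto intro: divide_strict_right_mono)

lemma grid_increment_distributed:
  assumes "T = 1" "j < Suc n"
  shows "distributed M lborel (\<lambda>\<omega>. grid_increment (\<lambda>t. W t \<omega>) (Suc n) j)
           (normal_density 0 (sqrt (1 / real (Suc n))))"
proof -
  have "real (Suc j) / real (Suc n) - real j / real (Suc n) = 1 / real (Suc n)"
    by (simp add: diff_divide_distrib[symmetric])
  moreover have "real j / real (Suc n) < real (Suc j) / real (Suc n)"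
    by (intro divide_strict_right_mono) auto
  ultimately show ?thesis
    using gaussian_increments[of "real j / real (Suc n)" "real (Suc j) / real (Suc n)"] assms
    by (simp add: grid_increment_def)
qed

text \<open>The upper bound is uniform in \<open>n\<close>, as Fatou's lemma requires. In the lower
  bound \<open>e\<close> stays fixed while \<open>n\<close> grows, so its two error terms can be
  removed one after the other.\<close>

lemma expectation_zigzag_value_grid:
  assumes "T = 1" "0 < l"
  defines "a \<equiv> \<lambda>n \<omega>. zigzag_value l (grid_increment (\<lambda>t. W t \<omega>) (Suc n)) (Suc n)"
  shows "integrable M (a n)"
    and "expectation (a n) \<le> 1 / l + l"
    and "0 < e \<Longrightarrow> 1 - e / l - 3 / e\<^sup>2 * inverse (real (Suc n)) \<le> l * expectation (a n)"
proof -
  define X where "X = (\<lambda>j \<omega>. grid_increment (\<lambda>t. W t \<omega>) (Suc n) j)"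
  have pos: "0 < sqrt (1 / real (Suc n))" by simp
  have D: "distributed M lborel (X j) (normal_density 0 (sqrt (1 / real (Suc n))))" if "j < Suc n" for j
    using grid_increment_distributed[OF assms(1) that] by (simp add: X_def)
  note mom = centred_normal_moments[OF pos D]
  have indep: "indep_vars (\<lambda>_. borel) X {..<Suc n}"
    using grid_increment_indep[OF assms(1)] by (simp add: X_def)
  have int: "j < Suc n \<Longrightarrow> integrable M (X j)" for j
    using mom(1)[of j 1] by simp
  have sq: "(sqrt (1 / real (Suc n)))\<^sup>2 = 1 / real (Suc n)"
    by simp
  then have "(sqrt (1 / real (Suc n))) ^ 4 = (1 / real (Suc n))\<^sup>2"
    by (metis power2_eq_square power4_eq_xxxx mult.assoc)
  note prems = assms(2) indep int mom(1)[of _ 2] mom(1)[of _ 4] mom(2) mom(3)[unfolded sq] mom(4)[unfolded this]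
  have a: "a n = (\<lambda>\<omega>. zigzag_value l (\<lambda>i. X i \<omega>) (Suc n))"
    by (simp add: a_def X_def)
  show "integrable M (a n)"
    unfolding a by (rule integrable_zigzag_value[OF prems])
  show "expectation (a n) \<le> 1 / l + l"
    using expectation_zigzag_value_le[OF prems] unfolding a by simp
  show "1 - e / l - 3 / e\<^sup>2 * inverse (real (Suc n)) \<le> l * expectation (a n)" if "0 < e"
  proof -
    let ?c = "real (Suc n)"
    have "1 - e / l - 3 / e\<^sup>2 * inverse ?c
        = ?c * (1 / ?c) - e * (?c * (1 / ?c) / l) - ?c * (3 * (1 / ?c)\<^sup>2) / e\<^sup>2"
      by (simp add: power2_eq_square inverse_eq_divide del: of_nat_Suc)
    also have "\<dots> \<le> l * expectation (a n)"
      unfolding a by (rule expectation_zigzag_value_ge[OF prems that]) auto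
    finally show ?thesis .
  qed
qed

lemma reg_total_variation_expectation:
  assumes T: "T = 1" and l: "0 < l"
  defines "\<Phi> \<equiv> \<lambda>\<omega>. reg_total_variation 0 1 l (\<lambda>t. W t \<omega>)"
  shows "integrable M \<Phi>" "1 / l \<le> expectation \<Phi>" "expectation \<Phi> \<le> 1 / l + l"
proof -
  define a where "a n \<omega> = zigzag_value l (grid_increment (\<lambda>t. W t \<omega>) (Suc n)) (Suc n)" for n \<omega>
  note grid = expectation_zigzag_value_grid[OF T l, folded a_def]
  have lim: "(\<lambda>n. a n \<omega>) \<longlonglongrightarrow> \<Phi> \<omega>" and le: "a n \<omega> \<le> \<Phi> \<omega>" if "\<omega> \<in> space M" for \<omega> n
    using continuous_paths[OF that] T l unfolding a_def \<Phi>_def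
    by (auto intro: zigzag_value_grid_tendsto zigzag_value_grid_le)
  have nonneg: "0 \<le> a n \<omega>" for n \<omega>
    by (simp add: a_def zigzag_value_nonneg)
  then have \<Phi>_nonneg: "0 \<le> \<Phi> \<omega>" if "\<omega> \<in> space M" for \<omega>
    using le[OF that] order_trans by blast
  \<comment> \<open>The supremum runs over uncountably many partitions; measurability comes from the
    countable sequence of grid values converging to it.\<close>
  have [measurable]: "\<Phi> \<in> borel_measurable M"
    using borel_measurable_integrable[OF grid(1)] by (intro borel_measurable_LIMSEQ_real[OF lim])
  have nn: "(\<integral>\<^sup>+\<omega>. ennreal (\<Phi> \<omega>) \<partial>M) \<le> ennreal (1 / l + l)"
    using grid nonneg lim by (intro nn_integral_lim_le[of M a]) auto
  then show int: "integrable M \<Phi>"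
    using \<Phi>_nonneg by (intro integrableI_nonneg AE_I2) (auto intro: le_less_trans)
  have "ennreal (expectation \<Phi>) \<le> ennreal (1 / l + l)"
    using nn nn_integral_eq_integral[OF int] \<Phi>_nonneg by simp
  then show "expectation \<Phi> \<le> 1 / l + l"
    using l by (subst (asm) ennreal_le_iff) auto
  \<comment> \<open>First limit: \<open>n\<close> tends to infinity with \<open>e\<close> fixed,
    using that grid values lie below the supremum.\<close>
  have "1 - e / l \<le> l * expectation \<Phi>" if e: "0 < e" for e
  proof (rule LIMSEQ_le_const2)
    have "(\<lambda>n. 1 - e / l - 3 / e\<^sup>2 * inverse (real (Suc n))) \<longlonglongrightarrow> 1 - e / l - 3 / e\<^sup>2 * 0"
      by (intro tendsto_intros LIMSEQ_inverse_real_of_nat)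
    then show "(\<lambda>n. 1 - e / l - 3 / e\<^sup>2 * inverse (real (Suc n))) \<longlonglongrightarrow> 1 - e / l"
      by simp
    have "l * expectation (a n) \<le> l * expectation \<Phi>" for n
      using l le by (intro mult_left_mono integral_mono grid(1) int) auto
    then show "\<exists>N. \<forall>n\<ge>N. 1 - e / l - 3 / e\<^sup>2 * inverse (real (Suc n)) \<le> l * expectation \<Phi>"
      using grid(3)[OF e] order_trans by blast
  qed
  \<comment> \<open>Second limit: replacing \<open>e\<close> by \<open>e * l\<close> turns the
    remaining error into \<open>e\<close> itself, which is then arbitrary.\<close>
  then have "1 \<le> l * expectation \<Phi> + e" if "0 < e" for e
    using \<open>\<And>e. 0 < e \<Longrightarrow> 1 - e / l \<le> l * expectation \<Phi>\<close>[of "e * l"] l that by simp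
  then have "1 \<le> l * expectation \<Phi>"
    by (rule field_le_epsilon)
  then show "1 / l \<le> expectation \<Phi>"
    using l by (simp add: pos_divide_le_eq mult.commute)
qed

end

text \<open>Integrability accompanies the bounds because the integral of a non-integrable function
  is 0 by default.\<close>

theorem theorem1:
  fixes M :: "'a measure" and W :: "real \<Rightarrow> 'a \<Rightarrow> real"
  assumes "standard_brownian_motion M 1 W"
  shows "(\<forall>l>0. integrable M (\<lambda>\<omega>. reg_total_variation 0 1 l (\<lambda>t. W t \<omega>)) \<and>
            0 \<le> (LINT \<omega>|M. reg_total_variation 0 1 l (\<lambda>t. W t \<omega>)) - 1 / l \<and>
            (LINT \<omega>|M. reg_total_variation 0 1 l (\<lambda>t. W t \<omega>)) - 1 / l \<le> l) \<and>
         (\<lambda>l. (LINT \<omega>|M. reg_total_variation 0 1 l (\<lambda>t. W t \<omega>)) - 1 / l) \<in> O[at_right 0](\<lambda>l. l)"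
proof
  note bounds = standard_brownian_motion.reg_total_variation_expectation[OF assms refl]
  show *: "\<forall>l>0. integrable M (\<lambda>\<omega>. reg_total_variation 0 1 l (\<lambda>t. W t \<omega>)) \<and>
            0 \<le> (LINT \<omega>|M. reg_total_variation 0 1 l (\<lambda>t. W t \<omega>)) - 1 / l \<and>
            (LINT \<omega>|M. reg_total_variation 0 1 l (\<lambda>t. W t \<omega>)) - 1 / l \<le> l"
    using bounds by (auto simp: algebra_simps)
  show "(\<lambda>l. (LINT \<omega>|M. reg_total_variation 0 1 l (\<lambda>t. W t \<omega>)) - 1 / l) \<in> O[at_right 0](\<lambda>l. l)"
    \<comment> \<open>The two-sided bound holds for every positive \<open>l\<close>, so the constant
      1 works and the filter only has to provide positivity.\<close>
    using * by (intro bigoI[where c = 1] eventually_mono[OF eventually_at_right_less]) auto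
qed

end
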